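(* Let $A \in \mathbb{R}^{n\times p}$ be a matrix with rows $n^{-1/2}a_i$, $i \in \{1,\ldots,n\}$, where $\{a_i\}_{i=1}^n$ are independent and identically distributed sub-Gaussian vectors in $\mathbb{R}^p$, satisfying $\|a_1\|_{\psi_2} \leq U$ and $\mathrm{Cov}(a_1) = \Sigma$, with $\sigma_{\min}(\Sigma) = (1-\zeta)^2$, $\sigma_{\max}(\Sigma) = (1+\zeta)^2$ and $\zeta \in (0,1)$. Assume that there exist absolute constants $c_1, c_2 > 0$ such that \[ c_1\sqrt{n}\,\phi_n \leq \{t\sqrt{p} + \log(p)\}\{\sqrt{p} + \sqrt{\log(n)}\} \leq c_2 n^{3/2}, \] for some diverging sequence $\phi_n$, with $\phi_n U^{-4} \to \infty$, as $n$ grows unbounded. For any $x \in \mathcal{X}(t) = \{v\in\mathbb{R}^p:\ \|Dv\|_1\le t,\ \|v\|=1\}$, it holds with probability at least \[ 1 - 2n^{-c_3} - 2\exp(-c_4 U^{-4}\phi_n), \] where $c_3, c_4 > 0$ are absolute constants, that \[ 1 - \zeta - 2^{-1/2}(1-\zeta) \leq \|Ax\| \leq 1 + \zeta + 2^{-1/2}(1-\zeta). \]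
   Context: $\|\cdot\|$ and $\|\cdot\|_1$ are the $\ell_2$- and $\ell_1$-norms of a vector. $D \in \mathbb{R}^{(p-1)\times p}$ is the difference operator $D_{ij} = \mathbf{1}\{i=j\} - \mathbf{1}\{j-i=1\}$, so $(Dv)_i = v_i - v_{i+1}$. $\sigma_{\min}(\cdot)$ and $\sigma_{\max}(\cdot)$ denote the smallest and largest singular values. $\|\cdot\|_{\psi_2}$ is the sub-Gaussian norm: for a random vector $a$, $\|a\|_{\psi_2} = \sup_{\|u\|=1}\|u^\top a\|_{\psi_2}$, where for a random variable $Z$, $\|Z\|_{\psi_2} = \inf\{r>0: \mathbb{E}\exp(Z^2/r^2)\le 2\}$. The number $t \ge 0$ is the total variation level defining $\mathcal{X}(t)$, and the dimension $p$ is allowed to be a function of the sample size $n$.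
   Formalization: The vectors a_i are additionally assumed to have mean zero (a large mean makes the upper bound on ‖Ax‖ fail), and the probability bound is claimed for all n ≥ N, where N depends only on ζ, c_1, c_2 (absolute c_3, c_4 fail at fixed n as ζ → 1). *)

theory Defs
  imports "HOL-Probability.Probability" "Jordan_Normal_Form.Char_Poly"
begin

unbundle no vec_syntax
unbundle no inner_syntax

text \<open>
  Since the dimension varies with the sample size, vectors and matrices are those of
  \<open>Jordan_Normal_Form\<close>; indices start at 0, so the sample \<open>a\<^sub>1, \<dots>, a\<^sub>n\<close> is \<open>a 0, \<dots>, a (n - 1)\<close>.
\<close>

definition l2_norm :: "real vec \<Rightarrow> real" where
  "l2_norm v = sqrt (\<Sum>i<dim_vec v. (v $ i)\<^sup>2)"

definition l1_norm :: "real vec \<Rightarrow> real" where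
  "l1_norm v = (\<Sum>i<dim_vec v. \<bar>v $ i\<bar>)"

definition diff_op :: "nat \<Rightarrow> real mat" where
  "diff_op p = mat (p - 1) p (\<lambda>(i, j). of_bool (i = j) - of_bool (j = i + 1))"

definition TV_class :: "nat \<Rightarrow> real \<Rightarrow> real vec set" where
  "TV_class p t = {v \<in> carrier_vec p. l1_norm (diff_op p *\<^sub>v v) \<le> t \<and> l2_norm v = 1}"

text \<open>Only used for square matrices: for a wide matrix, \<open>A\<^sup>T A\<close> would contribute spurious zeros.\<close>

definition singular_values :: "real mat \<Rightarrow> real set" where
  "singular_values A = {sqrt e | e. eigenvalue (transpose_mat A * A) e}"

definition sigma_min :: "real mat \<Rightarrow> real" where
  "sigma_min A = Min (singular_values A)"

definition sigma_max :: "real mat \<Rightarrow> real" where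
  "sigma_max A = Max (singular_values A)"

text \<open>The Borel sigma-algebra of \<open>\<real>\<^sup>p\<close>, transported from the product of \<open>p\<close> copies of \<open>borel\<close>.\<close>

definition vec_borel :: "nat \<Rightarrow> real vec measure" where
  "vec_borel p = vimage_algebra (carrier_vec p) (\<lambda>v. \<lambda>j\<in>{..<p}. v $ j)
     (\<Pi>\<^sub>M j\<in>{..<p}. (borel :: real measure))"

text \<open>
  The expectation is a nonnegative integral (a Bochner integral would be 0 when
  \<open>exp (Z\<^sup>2 / r\<^sup>2)\<close> is not integrable), and the norm is \<open>\<infinity>\<close> if no \<open>r\<close> qualifies.
\<close>

definition psi2_norm :: "'w measure \<Rightarrow> ('w \<Rightarrow> real) \<Rightarrow> ennreal" where
  "psi2_norm M Z =
     Inf {ennreal r | r. 0 < r \<and> (\<integral>\<^sup>+\<omega>. ennreal (exp ((Z \<omega>)\<^sup>2 / r\<^sup>2)) \<partial>M) \<le> 2}"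

definition psi2_norm_vec :: "'w measure \<Rightarrow> nat \<Rightarrow> ('w \<Rightarrow> real vec) \<Rightarrow> ennreal" where
  "psi2_norm_vec M p a =
     (SUP u \<in> {u \<in> carrier_vec p. l2_norm u = 1}. psi2_norm M (\<lambda>\<omega>. u \<bullet> a \<omega>))"

definition mean_vec :: "'w measure \<Rightarrow> nat \<Rightarrow> ('w \<Rightarrow> real vec) \<Rightarrow> real vec" where
  "mean_vec M p a = vec p (\<lambda>j. integral\<^sup>L M (\<lambda>\<omega>. a \<omega> $ j))"

definition cov_mat :: "'w measure \<Rightarrow> nat \<Rightarrow> ('w \<Rightarrow> real vec) \<Rightarrow> real mat" where
  "cov_mat M p a = mat p p (\<lambda>(j, k). integral\<^sup>L M
     (\<lambda>\<omega>. (a \<omega> $ j - mean_vec M p a $ j) * (a \<omega> $ k - mean_vec M p a $ k)))"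

definition iid_vecs :: "'w measure \<Rightarrow> nat \<Rightarrow> nat \<Rightarrow> (nat \<Rightarrow> 'w \<Rightarrow> real vec) \<Rightarrow> bool" where
  "iid_vecs M p n a \<longleftrightarrow>
     prob_space.indep_vars M (\<lambda>_. vec_borel p) a {..<n} \<and>
     (\<forall>i<n. distr M (vec_borel p) (a i) = distr M (vec_borel p) (a 0))"

definition design_mat :: "nat \<Rightarrow> nat \<Rightarrow> (nat \<Rightarrow> 'w \<Rightarrow> real vec) \<Rightarrow> 'w \<Rightarrow> real mat" where
  "design_mat n p a \<omega> = mat_of_rows p (map (\<lambda>i. (1 / sqrt (real n)) \<cdot>\<^sub>v a i \<omega>) [0..<n])"

text \<open>
  The distributional assumptions on a sample of size \<open>n\<close>. Sub-Gaussian vectors are centered, by the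
  usual convention: without it a large mean would leave the covariance unchanged but not the
  size of \<open>A x\<close>.
\<close>

definition subgaussian_sample ::
  "'w measure \<Rightarrow> nat \<Rightarrow> nat \<Rightarrow> (nat \<Rightarrow> 'w \<Rightarrow> real vec) \<Rightarrow> real \<Rightarrow> real mat \<Rightarrow> real \<Rightarrow> bool" where
  "subgaussian_sample M n p a U S \<zeta> \<longleftrightarrow>
     prob_space M \<and> iid_vecs M p n a \<and>
     mean_vec M p (a 0) = 0\<^sub>v p \<and>
     psi2_norm_vec M p (a 0) \<le> ennreal U \<and>
     cov_mat M p (a 0) = S \<and>
     sigma_min S = (1 - \<zeta>)\<^sup>2 \<and> sigma_max S = (1 + \<zeta>)\<^sup>2"

end

theory Submission
  imports Defs
begin

text \<open>
  For a fixed unit vector \<open>x\<close>, \<open>\<parallel>A x\<parallel>\<^sup>2\<close> is the average of \<open>n\<close> i.i.d. variables \<open>Z\<^sup>2\<close> with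
  \<open>Z = x\<^sup>T a\<close>, whose mean \<open>x\<^sup>T \<Sigma> x\<close> lies in \<open>[(1 - \<zeta>)\<^sup>2, (1 + \<zeta>)\<^sup>2]\<close>. Interpolating between the
  second moment, which is at most 4, and the sixth, of order \<open>U\<^sup>6\<close>, gives a fourth moment of order
  only \<open>U\<^sup>3\<close>, so Chebyshev's inequality bounds the failure probability by a multiple of
  \<open>U\<^sup>3 / (n (1 - \<zeta>)\<^sup>4)\<close>. The growth condition forces \<open>\<phi> \<le> (c\<^sub>2 / c\<^sub>1) n\<close>. If \<open>\<phi> / U\<^sup>4 \<le> ln 2\<close>, the
  claimed probability bound is not positive; otherwise \<open>U\<^sup>4 = O(n)\<close>, the failure probability is
  \<open>O(n\<^sup>-\<^sup>1\<^sup>/\<^sup>4)\<close>, and \<open>c\<^sub>3 = 1/8\<close> absorbs the constants for large \<open>n\<close>.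
\<close>

section \<open>Extremal eigenvectors of symmetric matrices\<close>

text \<open>Close to zero the linear term dominates the quadratic one: at \<open>e = - b / d\<close>
  with \<open>d\<close> above \<open>c\<close> and positive, the value is
  \<open>(b / d)^2 * (c - d)\<close>, negative unless \<open>b = 0\<close>. This is the first-order
  condition at an extremum.\<close>

lemma linear_coeff_zero_of_nonneg:
  fixes b c :: real
  assumes "\<And>e. 0 \<le> b * e + c * e\<^sup>2"
  shows "b = 0"
proof (rule ccontr)
  assume "b \<noteq> 0"
  define d where "d = \<bar>c\<bar> + 1"
  have "d > 0" "c < d" by (auto simp: d_def)
  have "0 \<le> b * (- b / d) + c * (- b / d)\<^sup>2" by (rule assms)
  also have "\<dots> = (b / d)\<^sup>2 * (c - d)"
    using \<open>d > 0\<close> by (simp add: field_simps power2_eq_square)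
  also have "\<dots> < 0"
    using \<open>b \<noteq> 0\<close> \<open>d > 0\<close> \<open>c < d\<close> by (intro mult_pos_neg) auto
  finally show False by simp
qed

text \<open>
  A maximizer \<open>v\<close> of the quadratic form on the compact unit sphere is an eigenvector: the form
  \<open>l \<parallel>x\<parallel>\<^sup>2 - q x\<close> is nonnegative and vanishes at \<open>v\<close>, hence is stationary there.
\<close>

lemma symmetric_max_eigenvector:
  fixes s :: "nat \<Rightarrow> nat \<Rightarrow> real"
  assumes p: "1 \<le> p" and sym: "\<And>i j. i < p \<Longrightarrow> j < p \<Longrightarrow> s i j = s j i"
  obtains v l where "(\<Sum>i<p. (v i)\<^sup>2) = 1" "\<And>i. i < p \<Longrightarrow> (\<Sum>j<p. s i j * v j) = l * v i"
    "\<And>x. (\<Sum>i<p. \<Sum>j<p. s i j * x i * x j) \<le> l * (\<Sum>i<p. (x i)\<^sup>2)"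
proof -
  define q where "q x = (\<Sum>i<p. \<Sum>j<p. s i j * x i * x j)" for x :: "nat \<Rightarrow> real"
  define N where "N x = (\<Sum>i<p. (x i)\<^sup>2)" for x :: "nat \<Rightarrow> real"
  \<comment> \<open>Vectors are functions on all of \<open>nat\<close>. Pinning the coordinates from
    \<open>p\<close> on to 0 makes \<open>B\<close> a product of compact sets, so Tychonoff's
    theorem applies.\<close>
  define B where "B = (PiE UNIV (\<lambda>i. if i < p then {-1..1} else {0}) :: (nat \<Rightarrow> real) set)"
  define K where "K = B \<inter> {x. N x = 1}"
  have contN: "continuous_on UNIV N" and contq: "continuous_on UNIV q"
    unfolding N_def q_def by (intro continuous_intros continuous_on_product_coordinates)+
  have "compactin (product_topology (\<lambda>i. euclidean) UNIV) B"
    unfolding B_def by (subst compactin_PiE) auto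
  then have "compact B"
    by (simp add: euclidean_product_topology)
  moreover have "closed {x. N x = 1}"
    by (intro closed_Collect_eq contN continuous_on_const)
  ultimately have "compact K"
    unfolding K_def by (rule compact_Int_closed)
  \<comment> \<open>The first standard basis vector, available because \<open>1 \<le> p\<close>,
    lies on the sphere.\<close>
  have "(\<Sum>i<p. (of_bool (i = 0) :: real)\<^sup>2) = (\<Sum>i<p. if i = 0 then 1 else 0)"
    by (intro sum.cong) auto
  then have "(\<lambda>i. of_bool (i = 0)) \<in> K"
    using p by (auto simp: K_def B_def N_def)
  then have "K \<noteq> {}" by blast
  obtain v where v: "v \<in> K" "\<And>x. x \<in> K \<Longrightarrow> q x \<le> q v"
    using continuous_attains_sup[OF \<open>compact K\<close> \<open>K \<noteq> {}\<close> continuous_on_subset[OF contq]] by auto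
  have Nv: "N v = 1" using v by (simp add: K_def)
  \<comment> \<open>Both sides are homogeneous of degree 2, so it is enough to compare
    \<open>v\<close> with the normalization \<open>y\<close> of \<open>x\<close>, cut off at
    \<open>p\<close> so that it lies in \<open>B\<close>.\<close>
  have bound: "q x \<le> q v * N x" for x
  proof (cases "N x = 0")
    case True
    then have "\<forall>i<p. x i = 0" by (auto simp: N_def sum_nonneg_eq_0_iff)
    then show ?thesis using True by (simp add: q_def)
  next
    case False
    have "N x \<ge> 0" by (simp add: N_def sum_nonneg)
    with False have pos: "N x > 0" by simp
    define y where "y i = (if i < p then x i / sqrt (N x) else 0)" for i
    have sq: "(y i)\<^sup>2 = (x i)\<^sup>2 / N x" if "i < p" for i
      using that pos by (simp add: y_def power_divide)
    have "N y = N x / N x"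
      by (simp add: N_def[of y] sq sum_divide_distrib[symmetric]) (simp add: N_def)
    then have Ny: "N y = 1" using pos by simp
    have "\<bar>y i\<bar> \<le> 1" if "i < p" for i
    proof -
      have "(y i)\<^sup>2 \<le> N y"
        unfolding N_def using that by (intro member_le_sum) auto
      then show ?thesis by (simp add: Ny abs_square_le_1)
    qed
    then have "-1 \<le> y i \<and> y i \<le> 1" if "i < p" for i
      using that by (simp add: abs_le_iff minus_le_iff)
    moreover have "y i = 0" if "\<not> i < p" for i
      using that by (simp add: y_def)
    ultimately have "y \<in> B" by (simp add: B_def PiE_iff)
    then have "q y \<le> q v" using v Ny by (simp add: K_def)
    moreover have "q y = q x / N x"
    proof -
      have "s i j * y i * y j = s i j * x i * x j / N x" if "i < p" "j < p" for i j
        using that pos by (simp add: y_def field_simps)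
      then show ?thesis by (simp add: q_def sum_divide_distrib)
    qed
    ultimately show ?thesis using pos by (simp add: field_simps)
  qed
  have delta: "(\<Sum>j<p. f j * of_bool (j = k)) = f k"
    and delta': "(\<Sum>j<p. of_bool (j = k) * f j) = f k"
    if "k < p" for f :: "nat \<Rightarrow> real" and k
    using that by (simp_all add: of_bool_def if_distrib if_distribR cong: if_cong)
  have eig: "(\<Sum>j<p. s k j * v j) = q v * v k" if k: "k < p" for k
  proof -
    define g where "g = (\<Sum>j<p. s k j * v j)"
    \<comment> \<open>Perturb \<open>v\<close> in coordinate \<open>k\<close> only and expand
      \<open>bound\<close> at \<open>w\<close>. The constant terms cancel because
      \<open>N v = 1\<close>, and the linear coefficient is twice the defect in row \<open>k\<close>
      of the eigenvalue equation.\<close>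
    have "0 \<le> (2 * (q v * v k - g)) * e + (q v - s k k) * e\<^sup>2" for e
    proof -
      define w where "w i = v i + e * of_bool (i = k)" for i
      have Nw: "N w = 1 + 2 * e * v k + e\<^sup>2"
      proof -
        have "N w = (\<Sum>i<p. (v i)\<^sup>2 + (2 * e * v k + e\<^sup>2) * of_bool (i = k))"
          unfolding N_def w_def by (intro sum.cong) (auto simp: power2_eq_square algebra_simps)
        also have "\<dots> = N v + (2 * e * v k + e\<^sup>2)"
          using k by (simp add: sum.distrib N_def delta)
        finally show ?thesis using Nv by simp
      qed
      have qw: "q w = q v + 2 * e * g + e\<^sup>2 * s k k"
      proof -
        have "q w = (\<Sum>i<p. \<Sum>j<p. s i j * v i * v j + e * v i * (s i j * of_bool (j = k))
            + of_bool (i = k) * (e * s i j * v j + e\<^sup>2 * s i j * of_bool (j = k)))"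
          unfolding q_def w_def
          by (intro sum.cong) (auto simp: power2_eq_square algebra_simps)
        also have "\<dots> = (\<Sum>i<p. (\<Sum>j<p. s i j * v i * v j) + e * v i * s i k
            + of_bool (i = k) * (e * (\<Sum>j<p. s i j * v j) + e\<^sup>2 * s i k))"
          using k by (intro sum.cong refl)
            (simp add: sum.distrib sum_distrib_left[symmetric] mult.assoc delta)
        also have "\<dots> = q v + (\<Sum>i<p. e * v i * s i k) + (e * g + e\<^sup>2 * s k k)"
          using k by (simp add: sum.distrib q_def g_def delta')
        also have "(\<Sum>i<p. e * v i * s i k) = e * g"
          using sym k by (auto simp: g_def sum_distrib_left mult_ac intro!: sum.cong)
        finally show ?thesis by simp
      qed
      show ?thesis using bound[of w] unfolding Nw qw by (simp add: algebra_simps)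
    qed
    from linear_coeff_zero_of_nonneg[OF this] show ?thesis by (simp add: g_def)
  qed
  show thesis
    by (rule that[of v "q v"]) (use Nv eig bound in \<open>auto simp: N_def q_def\<close>)
qed

section \<open>Quadratic forms and extreme singular values\<close>

lemma mult_mat_vec_nth_sum:
  "S \<in> carrier_mat m p \<Longrightarrow> x \<in> carrier_vec p \<Longrightarrow> i < m \<Longrightarrow>
    (S *\<^sub>v x) $ i = (\<Sum>j<p. S $$ (i, j) * x $ j)"
  by (auto simp: scalar_prod_def lessThan_atLeast0)

lemma scalar_prod_mult_mat_vec:
  fixes x :: "real vec"
  assumes "S \<in> carrier_mat p p" "x \<in> carrier_vec p"
  shows "x \<bullet> (S *\<^sub>v x) = (\<Sum>i<p. \<Sum>j<p. S $$ (i, j) * x $ i * x $ j)"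
proof -
  have "x \<bullet> (S *\<^sub>v x) = (\<Sum>i<p. x $ i * (S *\<^sub>v x) $ i)"
    using assms by (simp add: scalar_prod_def lessThan_atLeast0)
  also have "\<dots> = (\<Sum>i<p. \<Sum>j<p. S $$ (i, j) * x $ i * x $ j)"
    using assms by (intro sum.cong refl)
      (simp add: mult_mat_vec_nth_sum[OF assms] sum_distrib_left mult_ac del: index_mult_mat_vec)
  finally show ?thesis .
qed

text \<open>They are images of the roots of a monic characteristic polynomial. Finiteness is what
  lets \<open>Min\<close> and \<open>Max\<close> in \<open>sigma_min\<close> and
  \<open>sigma_max\<close> be compared with individual singular values.\<close>

lemma finite_singular_values:
  assumes "S \<in> carrier_mat p p"
  shows "finite (singular_values S)"
proof -
  have T: "transpose_mat S * S \<in> carrier_mat p p" using assms by auto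
  have "finite {e. poly (char_poly (transpose_mat S * S)) e = 0}"
    using degree_monic_char_poly[OF T] by (intro poly_roots_finite) auto
  then have "finite {e. eigenvalue (transpose_mat S * S) e}"
    by (simp add: eigenvalue_root_char_poly[OF T])
  then show ?thesis
    unfolding singular_values_def by (simp add: setcompr_eq_image)
qed

text \<open>For symmetric \<open>S\<close> the Gram matrix is the square of \<open>S\<close>, with
  eigenvalue \<open>l^2\<close> at \<open>v\<close>; the sign condition gives
  \<open>sqrt (l^2) = l\<close>.\<close>

lemma eigenvalue_in_singular_values:
  assumes S: "S \<in> carrier_mat p p" and sym: "transpose_mat S = S" and l: "0 \<le> l"
    and v: "v \<in> carrier_vec p" "v \<noteq> 0\<^sub>v p" "S *\<^sub>v v = l \<cdot>\<^sub>v v"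
  shows "l \<in> singular_values S"
proof -
  have "(S * S) *\<^sub>v v = S *\<^sub>v (l \<cdot>\<^sub>v v)"
    using S v by (simp add: assoc_mult_mat_vec[of _ p p _ p])
  also have "\<dots> = l\<^sup>2 \<cdot>\<^sub>v v"
    using S v by (simp add: mult_mat_vec[of S p p v] smult_smult_assoc power2_eq_square)
  finally have "eigenvector (transpose_mat S * S) v (l\<^sup>2)"
    using S v by (auto simp: eigenvector_def sym)
  then show ?thesis
    using l by (auto simp: singular_values_def eigenvalue_def intro!: exI[of _ "l\<^sup>2"])
qed

text \<open>The extreme values of the form on the unit sphere are eigenvalues of \<open>S\<close>.
  Positive semidefiniteness makes these nonnegative, hence singular values, and so they lie between
  \<open>sigma_min S\<close> and \<open>sigma_max S\<close>.\<close>

lemma sigma_quadratic_form_bounds: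
  assumes p: "1 \<le> p" and S: "S \<in> carrier_mat p p" and symS: "transpose_mat S = S"
    and psd: "\<And>x. x \<in> carrier_vec p \<Longrightarrow> 0 \<le> x \<bullet> (S *\<^sub>v x)"
    and x: "x \<in> carrier_vec p" "l2_norm x = 1"
  shows "sigma_min S \<le> x \<bullet> (S *\<^sub>v x)" "x \<bullet> (S *\<^sub>v x) \<le> sigma_max S"
proof -
  have sym: "S $$ (i, j) = S $$ (j, i)" if "i < p" "j < p" for i j
    using arg_cong[OF symS, of "\<lambda>A. A $$ (i, j)"] that S by auto
  have Nx: "(\<Sum>i<p. (x $ i)\<^sup>2) = 1"
    using x by (simp add: l2_norm_def)
  \<comment> \<open>At a unit eigenvector the quadratic form equals \<open>l\<close>, so
    \<open>psd\<close> gives the sign of \<open>l\<close>.\<close>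
  have mem: "l \<in> singular_values S \<and> 0 \<le> l"
    if v: "(\<Sum>i<p. (v i)\<^sup>2) = 1" "\<And>i. i < p \<Longrightarrow> (\<Sum>j<p. S $$ (i, j) * v j) = l * v i"
    for v :: "nat \<Rightarrow> real" and l
  proof -
    define w where "w = vec p v"
    have w: "w \<in> carrier_vec p" by (simp add: w_def)
    have Sw: "S *\<^sub>v w = l \<cdot>\<^sub>v w"
    proof (rule eq_vecI)
      show "(S *\<^sub>v w) $ i = (l \<cdot>\<^sub>v w) $ i" if "i < dim_vec (l \<cdot>\<^sub>v w)" for i
      proof -
        have "i < p" using that by (simp add: w_def)
        then show ?thesis
          by (simp add: mult_mat_vec_nth_sum[OF S w] del: index_mult_mat_vec)
             (simp add: w_def v)
      qed
    qed (use S w in auto)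
    have ww: "w \<bullet> w = 1"
      using v(1) by (simp add: scalar_prod_def w_def power2_eq_square lessThan_atLeast0)
    then have "w \<noteq> 0\<^sub>v p" using w by auto
    moreover have "0 \<le> l" using psd[OF w] w by (simp add: Sw ww)
    ultimately show ?thesis
      using eigenvalue_in_singular_values[OF S symS _ w _ Sw] by blast
  qed
  have q: "x \<bullet> (S *\<^sub>v x) = (\<Sum>i<p. \<Sum>j<p. S $$ (i, j) * x $ i * x $ j)"
    by (rule scalar_prod_mult_mat_vec[OF S x(1)])
  note fin = finite_singular_values[OF S]
  obtain v l where v: "(\<Sum>i<p. (v i)\<^sup>2) = 1"
      "\<And>i. i < p \<Longrightarrow> (\<Sum>j<p. S $$ (i, j) * v j) = l * v i"
      "\<And>x. (\<Sum>i<p. \<Sum>j<p. S $$ (i, j) * x i * x j) \<le> l * (\<Sum>i<p. (x i)\<^sup>2)"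
    using symmetric_max_eigenvector[of p "\<lambda>i j. S $$ (i, j)"] p sym by auto
  have "l \<le> sigma_max S"
    unfolding sigma_max_def using mem[OF v(1,2)] fin by (intro Max_ge) auto
  then show "x \<bullet> (S *\<^sub>v x) \<le> sigma_max S"
    using v(3)[of "\<lambda>i. x $ i"] by (simp add: q Nx)
  \<comment> \<open>The lower bound is the same argument for \<open>- S\<close>: here
    \<open>- l\<close> is an eigenvalue of \<open>S\<close> and bounds the form from below.\<close>
  obtain v l where v: "(\<Sum>i<p. (v i)\<^sup>2) = 1"
      "\<And>i. i < p \<Longrightarrow> (\<Sum>j<p. - S $$ (i, j) * v j) = l * v i"
      "\<And>x. (\<Sum>i<p. \<Sum>j<p. - S $$ (i, j) * x i * x j) \<le> l * (\<Sum>i<p. (x i)\<^sup>2)"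
    using symmetric_max_eigenvector[of p "\<lambda>i j. - S $$ (i, j)"] p sym by auto
  have "(\<Sum>j<p. S $$ (i, j) * v j) = - l * v i" if "i < p" for i
    using v(2)[OF that] by (simp add: sum_negf)
  then have "sigma_min S \<le> - l"
    unfolding sigma_min_def using mem[OF v(1)] fin by (intro Min_le) auto
  then show "sigma_min S \<le> x \<bullet> (S *\<^sub>v x)"
    using v(3)[of "\<lambda>i. x $ i"] by (simp add: q Nx sum_negf)
qed

section \<open>Moments of sub-Gaussian variables\<close>

text \<open>Raise \<open>u / k \<le> exp (u / k)\<close> to the power \<open>k\<close>. This turns
  one exponential moment into bounds on all even moments.\<close>

lemma power_le_exp:
  fixes u :: real
  assumes "0 \<le> u" "0 < k"
  shows "u ^ k \<le> real k ^ k * exp u"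
proof -
  have "u / k \<le> exp (u / k)"
    using exp_ge_add_one_self[of "u / k"] by linarith
  then have "(u / k) ^ k \<le> exp (u / k) ^ k"
    using assms by (intro power_mono) auto
  also have "\<dots> = exp u"
    using assms by (simp add: exp_divide_power_eq)
  finally show ?thesis
    using assms by (simp add: power_divide field_simps)
qed

text \<open>Taking \<open>s\<close> strictly above \<open>r\<close> avoids the question whether the
  infimum is attained: some admissible radius lies below \<open>s\<close>, and the integrand
  decreases in the radius.\<close>

lemma psi2_norm_leD:
  assumes "psi2_norm M Z \<le> ennreal r" "0 \<le> r" "r < s"
  shows "(\<integral>\<^sup>+\<omega>. ennreal (exp ((Z \<omega>)\<^sup>2 / s\<^sup>2)) \<partial>M) \<le> 2"
proof -
  have "psi2_norm M Z < ennreal s"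
    using assms by (metis ennreal_less_iff le_less_trans)
  then obtain r' where r': "0 < r'" "ennreal r' < ennreal s"
      "(\<integral>\<^sup>+\<omega>. ennreal (exp ((Z \<omega>)\<^sup>2 / r'\<^sup>2)) \<partial>M) \<le> 2"
    by (auto simp: psi2_norm_def Inf_less_iff)
  then have "r' < s" by (simp add: ennreal_less_iff)
  have "(\<integral>\<^sup>+\<omega>. ennreal (exp ((Z \<omega>)\<^sup>2 / s\<^sup>2)) \<partial>M)
      \<le> (\<integral>\<^sup>+\<omega>. ennreal (exp ((Z \<omega>)\<^sup>2 / r'\<^sup>2)) \<partial>M)"
    using \<open>0 < r'\<close> \<open>r' < s\<close>
    by (intro nn_integral_mono ennreal_leI) (auto intro!: divide_left_mono power_mono)
  with r'(3) show ?thesis by (rule order_trans[rotated])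
qed

text \<open>Estimating \<open>Z ^ 4\<close> directly by the exponential would cost
  \<open>s ^ 4\<close>. Keeping the second moment reduces this to \<open>s ^ 3\<close>, which is
  decisive later: when \<open>s ^ 4\<close> is only known to be of order \<open>n\<close>,
  \<open>s ^ 3 / n\<close> still tends to 0. The constant is \<open>54 = 3 ^ 3 * 2\<close>, from
  \<open>power_le_exp\<close> with \<open>k = 3\<close> and the exponential moment 2.\<close>

lemma subgaussian_moments:
  fixes Z :: "'w \<Rightarrow> real"
  assumes [measurable]: "Z \<in> borel_measurable M" and s: "0 < s"
    and le2: "(\<integral>\<^sup>+\<omega>. ennreal (exp ((Z \<omega>)\<^sup>2 / s\<^sup>2)) \<partial>M) \<le> 2"
  shows "integrable M (\<lambda>\<omega>. (Z \<omega>)\<^sup>2)" "integrable M (\<lambda>\<omega>. (Z \<omega>) ^ 4)"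
    "integral\<^sup>L M (\<lambda>\<omega>. (Z \<omega>) ^ 4) \<le> s ^ 3 * (integral\<^sup>L M (\<lambda>\<omega>. (Z \<omega>)\<^sup>2) + 54) / 2"
proof -
  define E where "E \<omega> = exp ((Z \<omega>)\<^sup>2 / s\<^sup>2)" for \<omega>
  have [measurable]: "E \<in> borel_measurable M" unfolding E_def by measurable
  have "(\<integral>\<^sup>+\<omega>. ennreal (E \<omega>) \<partial>M) < \<infinity>"
    using le2 unfolding E_def by (rule le_less_trans) simp
  then have intE: "integrable M E"
    by (intro integrableI_nonneg) (auto simp: E_def)
  have "ennreal (integral\<^sup>L M E) \<le> ennreal 2"
    using le2 intE by (subst nn_integral_eq_integral[symmetric]) (auto simp: E_def)
  then have E2: "integral\<^sup>L M E \<le> 2"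
    by (subst (asm) ennreal_le_iff) auto
  have bound: "(Z \<omega>) ^ (2 * k) \<le> s ^ (2 * k) * (real k ^ k * E \<omega>)" if "0 < k" for k \<omega>
  proof -
    have "((Z \<omega>)\<^sup>2 / s\<^sup>2) ^ k \<le> real k ^ k * E \<omega>"
      unfolding E_def using that by (intro power_le_exp) auto
    then show ?thesis
      using s by (simp add: power_divide power_mult[symmetric] field_simps)
  qed
  have int: "integrable M (\<lambda>\<omega>. (Z \<omega>) ^ (2 * k))" if "0 < k" for k
  proof (rule Bochner_Integration.integrable_bound)
    show "integrable M (\<lambda>\<omega>. s ^ (2 * k) * (real k ^ k * E \<omega>))"
      using intE by auto
    show "AE \<omega> in M. norm ((Z \<omega>) ^ (2 * k)) \<le> norm (s ^ (2 * k) * (real k ^ k * E \<omega>))"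
    proof (rule AE_I2)
      fix \<omega>
      have "0 \<le> (Z \<omega>) ^ (2 * k)" by (simp add: zero_le_even_power)
      then show "norm ((Z \<omega>) ^ (2 * k)) \<le> norm (s ^ (2 * k) * (real k ^ k * E \<omega>))"
        using bound[OF that, of \<omega>] by simp
    qed
  qed auto
  show Z2: "integrable M (\<lambda>\<omega>. (Z \<omega>)\<^sup>2)" and Z4: "integrable M (\<lambda>\<omega>. (Z \<omega>) ^ 4)"
    using int[of 1] int[of 2] by simp_all
  \<comment> \<open>AM-GM: \<open>Z\<^sup>4\<close> is the geometric mean of \<open>s\<^sup>3 Z\<^sup>2\<close> and \<open>Z\<^sup>6 / s\<^sup>3\<close>.\<close>
  have "(Z \<omega>) ^ 4 \<le> (s ^ 3 * (Z \<omega>)\<^sup>2 + 27 * s ^ 3 * E \<omega>) / 2" for \<omega>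
  proof -
    have "0 \<le> (s ^ 3 - (Z \<omega>)\<^sup>2)\<^sup>2 * (Z \<omega>)\<^sup>2" by simp
    then have "2 * s ^ 3 * (Z \<omega>) ^ 4 \<le> s ^ 6 * (Z \<omega>)\<^sup>2 + (Z \<omega>) ^ 6"
      by (simp add: power2_eq_square algebra_simps power_def numeral_eq_Suc)
    also have "\<dots> \<le> s ^ 6 * (Z \<omega>)\<^sup>2 + s ^ 6 * (27 * E \<omega>)"
      using bound[of 3 \<omega>] by simp
    also have "\<dots> = s ^ 3 * (s ^ 3 * (Z \<omega>)\<^sup>2 + 27 * s ^ 3 * E \<omega>)"
      by (simp add: algebra_simps numeral_eq_Suc)
    finally have "s ^ 3 * (2 * (Z \<omega>) ^ 4) \<le> s ^ 3 * (s ^ 3 * (Z \<omega>)\<^sup>2 + 27 * s ^ 3 * E \<omega>)"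
      by (simp add: mult_ac)
    then show ?thesis using s by (subst (asm) mult_le_cancel_left_pos) auto
  qed
  then have "integral\<^sup>L M (\<lambda>\<omega>. (Z \<omega>) ^ 4)
      \<le> integral\<^sup>L M (\<lambda>\<omega>. (s ^ 3 * (Z \<omega>)\<^sup>2 + 27 * s ^ 3 * E \<omega>) / 2)"
    using Z2 Z4 intE by (intro integral_mono) auto
  also have "\<dots> = (s ^ 3 * integral\<^sup>L M (\<lambda>\<omega>. (Z \<omega>)\<^sup>2) + 27 * s ^ 3 * integral\<^sup>L M E) / 2"
    using Z2 intE by simp
  also have "\<dots> \<le> (s ^ 3 * integral\<^sup>L M (\<lambda>\<omega>. (Z \<omega>)\<^sup>2) + 27 * s ^ 3 * 2) / 2"
    using E2 s by (intro divide_right_mono add_left_mono mult_left_mono) auto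
  finally show "integral\<^sup>L M (\<lambda>\<omega>. (Z \<omega>) ^ 4) \<le> s ^ 3 * (integral\<^sup>L M (\<lambda>\<omega>. (Z \<omega>)\<^sup>2) + 54) / 2"
    by (simp add: algebra_simps)
qed

section \<open>Chebyshev's inequality for averages\<close>

lemma (in prob_space) indep_mean_deviation:
  fixes Y :: "nat \<Rightarrow> 'a \<Rightarrow> real"
  assumes ind: "indep_vars (\<lambda>_. borel) Y {..<n}" and n: "1 \<le> n" and d: "0 < d"
    and int: "\<And>i. i < n \<Longrightarrow> integrable M (\<lambda>\<omega>. (Y i \<omega>)\<^sup>2)"
    and m: "\<And>i. i < n \<Longrightarrow> expectation (Y i) = m"
    and V: "\<And>i. i < n \<Longrightarrow> expectation (\<lambda>\<omega>. (Y i \<omega>)\<^sup>2) \<le> V"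
  shows "prob {\<omega> \<in> space M. d \<le> \<bar>(\<Sum>i<n. Y i \<omega>) / n - m\<bar>} \<le> V / (n * d\<^sup>2)"
proof -
  have meas: "Y i \<in> borel_measurable M" if "i < n" for i
    using ind that by (auto simp: indep_vars_def)
  have int1: "integrable M (Y i)" if "i < n" for i
    using square_integrable_imp_integrable[OF meas[OF that] int[OF that]] .
  define C where "C i \<omega> = Y i \<omega> - m" for i \<omega>
  have indC: "indep_vars (\<lambda>_. borel) C {..<n}"
    unfolding C_def by (rule indep_vars_compose2[OF ind]) auto
  have intC: "integrable M (C i)" and EC: "expectation (C i) = 0" if "i < n" for i
    using int1[OF that] m[OF that] by (simp_all add: C_def[abs_def] prob_space)
  \<comment> \<open>The variance is the raw second moment minus \<open>m^2\<close>, so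
    \<open>V\<close> bounds it as well.\<close>
  have C2: "integrable M (\<lambda>\<omega>. C i \<omega> * C i \<omega>)" "expectation (\<lambda>\<omega>. C i \<omega> * C i \<omega>) \<le> V"
    if "i < n" for i
  proof -
    have eq: "C i \<omega> * C i \<omega> = (Y i \<omega>)\<^sup>2 - 2 * m * Y i \<omega> + m\<^sup>2" for \<omega>
      by (simp add: C_def power2_eq_square algebra_simps)
    show "integrable M (\<lambda>\<omega>. C i \<omega> * C i \<omega>)"
      unfolding eq using int[OF that] int1[OF that] by auto
    have "expectation (\<lambda>\<omega>. C i \<omega> * C i \<omega>) = expectation (\<lambda>\<omega>. (Y i \<omega>)\<^sup>2) - 2 * m * m + m\<^sup>2"
      unfolding eq using int[OF that] int1[OF that] m[OF that] by (simp add: prob_space)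
    also have "\<dots> \<le> V"
      using V[OF that] zero_le_square[of m] unfolding power2_eq_square[of m] by linarith
    finally show "expectation (\<lambda>\<omega>. C i \<omega> * C i \<omega>) \<le> V" .
  qed
  have cross: "integrable M (\<lambda>\<omega>. C i \<omega> * C j \<omega>)" "expectation (\<lambda>\<omega>. C i \<omega> * C j \<omega>) = 0"
    if "i < n" "j < n" "i \<noteq> j" for i j
  proof -
    have sub: "indep_vars (\<lambda>_. borel) C {i, j}"
      by (rule indep_vars_subset[OF indC]) (use that in auto)
    have ij: "\<And>k. k \<in> {i, j} \<Longrightarrow> integrable M (C k)" using intC that by auto
    show "integrable M (\<lambda>\<omega>. C i \<omega> * C j \<omega>)"
      using indep_vars_integrable[OF _ sub ij] that by simp
    show "expectation (\<lambda>\<omega>. C i \<omega> * C j \<omega>) = 0"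
      using indep_vars_lebesgue_integral[OF _ sub ij] that by (simp add: EC)
  qed
  have int2: "integrable M (\<lambda>\<omega>. C i \<omega> * C j \<omega>)" if "i < n" "j < n" for i j
    using cross[of i j] C2[of i] that by (cases "i = j") auto
  define W where "W \<omega> = (\<Sum>i<n. Y i \<omega>) / n - m" for \<omega>
  have W2: "(W \<omega>)\<^sup>2 = (\<Sum>i<n. \<Sum>j<n. C i \<omega> * C j \<omega>) / (real n)\<^sup>2" for \<omega>
  proof -
    have "W \<omega> = (\<Sum>i<n. C i \<omega>) / n"
      using n by (simp add: W_def C_def sum_subtractf field_simps)
    then show ?thesis
      by (simp add: power_divide power2_eq_square[of "sum _ _"] sum_product)
  qed
  have [measurable]: "W \<in> borel_measurable M"
    unfolding W_def using meas by auto
  have intr: "integrable M (\<lambda>\<omega>. \<Sum>j<n. C i \<omega> * C j \<omega>)" if "i < n" for i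
    by (rule Bochner_Integration.integrable_sum) (use int2 that in auto)
  have intW: "integrable M (\<lambda>\<omega>. (W \<omega>)\<^sup>2)"
    unfolding W2
    by (intro Bochner_Integration.integrable_divide Bochner_Integration.integrable_sum)
      (use int2 in auto)
  have "expectation (\<lambda>\<omega>. (W \<omega>)\<^sup>2)
      = expectation (\<lambda>\<omega>. \<Sum>i<n. \<Sum>j<n. C i \<omega> * C j \<omega>) / (real n)\<^sup>2"
    unfolding W2 by simp
  also have "expectation (\<lambda>\<omega>. \<Sum>i<n. \<Sum>j<n. C i \<omega> * C j \<omega>)
      = (\<Sum>i<n. expectation (\<lambda>\<omega>. \<Sum>j<n. C i \<omega> * C j \<omega>))"
    by (rule Bochner_Integration.integral_sum) (use intr in auto)
  also have "\<dots> = (\<Sum>i<n. \<Sum>j<n. expectation (\<lambda>\<omega>. C i \<omega> * C j \<omega>))"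
    by (intro sum.cong refl Bochner_Integration.integral_sum) (use int2 in auto)
  \<comment> \<open>By independence and centering the off-diagonal terms vanish, which leaves
    \<open>n\<close> of the \<open>n^2\<close> terms.\<close>
  also have "\<dots> = (\<Sum>i<n. expectation (\<lambda>\<omega>. C i \<omega> * C i \<omega>))"
  proof -
    have "(\<Sum>j<n. expectation (\<lambda>\<omega>. C i \<omega> * C j \<omega>)) = expectation (\<lambda>\<omega>. C i \<omega> * C i \<omega>)"
      if "i < n" for i
      using that cross(2) by (subst sum.remove[of _ i]) auto
    then show ?thesis by simp
  qed
  also have "\<dots> / (real n)\<^sup>2 \<le> (\<Sum>i<n. V) / (real n)\<^sup>2"
    using C2 by (intro divide_right_mono sum_mono) auto
  also have "\<dots> = V / n"
    using n by (simp add: power2_eq_square)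
  finally have EW: "expectation (\<lambda>\<omega>. (W \<omega>)\<^sup>2) \<le> V / n" .
  have "prob {\<omega> \<in> space M. d \<le> \<bar>W \<omega>\<bar>} \<le> expectation (\<lambda>\<omega>. (W \<omega>)\<^sup>2) / d\<^sup>2"
    using d intW by (intro second_moment_method) auto
  also have "\<dots> \<le> V / n / d\<^sup>2"
    using EW by (intro divide_right_mono) auto
  finally show ?thesis by (simp add: W_def)
qed

section \<open>Measurability, covariance and the design matrix\<close>

lemma vec_nth_measurable:
  "j < p \<Longrightarrow> (\<lambda>v. v $ j) \<in> borel_measurable (vec_borel p)"
proof -
  assume j: "j < p"
  have "(\<lambda>v. \<lambda>j\<in>{..<p}. v $ j) \<in> vec_borel p \<rightarrow>\<^sub>M (\<Pi>\<^sub>M j\<in>{..<p}. (borel :: real measure))"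
    unfolding vec_borel_def by (rule measurable_vimage_algebra1) (auto simp: space_PiM)
  then have "(\<lambda>v. (\<lambda>j\<in>{..<p}. v $ j) j) \<in> borel_measurable (vec_borel p)"
    by (rule measurable_compose) (use j in \<open>auto intro: measurable_component_singleton\<close>)
  then show ?thesis using j by simp
qed

lemma space_vec_borel [simp]: "space (vec_borel p) = carrier_vec p"
  by (simp add: vec_borel_def)

lemma scalar_prod_eq_sum:
  "v \<in> carrier_vec p \<Longrightarrow> x \<bullet> v = (\<Sum>i<p. x $ i * v $ i)"
  by (auto simp: scalar_prod_def lessThan_atLeast0)

lemma scalar_prod_measurable:
  fixes x :: "real vec"
  shows "(\<lambda>v. x \<bullet> v) \<in> borel_measurable (vec_borel p)"
proof -
  have "(\<lambda>v. \<Sum>i<p. x $ i * v $ i) \<in> borel_measurable (vec_borel p)"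
    by (intro borel_measurable_sum borel_measurable_times borel_measurable_const vec_nth_measurable)
      auto
  then show ?thesis
    by (rule measurable_cong[THEN iffD1, rotated]) (simp add: scalar_prod_eq_sum)
qed

text \<open>With mean zero the covariance entries are plain second moments, so the form is the
  expectation of the expanded square of \<open>x \<bullet> a\<close>. Square integrability of the
  coordinates justifies exchanging sums and integrals.\<close>

lemma cov_mat_quadratic_form:
  assumes a [measurable]: "a \<in> M \<rightarrow>\<^sub>M vec_borel p"
    and mean: "mean_vec M p a = 0\<^sub>v p"
    and sq: "\<And>j. j < p \<Longrightarrow> integrable M (\<lambda>\<omega>. (a \<omega> $ j)\<^sup>2)"
    and x: "x \<in> carrier_vec p"
  shows "x \<bullet> (cov_mat M p a *\<^sub>v x) = integral\<^sup>L M (\<lambda>\<omega>. (x \<bullet> a \<omega>)\<^sup>2)"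
proof -
  have meas: "(\<lambda>\<omega>. a \<omega> $ j) \<in> borel_measurable M" if "j < p" for j
    using measurable_compose[OF a vec_nth_measurable[OF that]] .
  have int: "integrable M (\<lambda>\<omega>. a \<omega> $ i * a \<omega> $ j)" if "i < p" "j < p" for i j
  proof (rule Bochner_Integration.integrable_bound)
    show "integrable M (\<lambda>\<omega>. (a \<omega> $ i)\<^sup>2 + (a \<omega> $ j)\<^sup>2)"
      using sq that by auto
    show "(\<lambda>\<omega>. a \<omega> $ i * a \<omega> $ j) \<in> borel_measurable M"
      using meas that by auto
    have "\<bar>u * v\<bar> \<le> u\<^sup>2 + v\<^sup>2" for u v :: real
    proof -
      have "2 * \<bar>u * v\<bar> \<le> u\<^sup>2 + v\<^sup>2"
        using sum_squares_bound[of "\<bar>u\<bar>" "\<bar>v\<bar>"] by (simp add: abs_mult)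
      then show ?thesis using zero_le_power2[of u] zero_le_power2[of v] by linarith
    qed
    then show "AE \<omega> in M. norm (a \<omega> $ i * a \<omega> $ j) \<le> norm ((a \<omega> $ i)\<^sup>2 + (a \<omega> $ j)\<^sup>2)"
      by simp
  qed
  have "x \<bullet> (cov_mat M p a *\<^sub>v x) = (\<Sum>i<p. x $ i * (\<Sum>j<p. cov_mat M p a $$ (i, j) * x $ j))"
    using x by (simp add: scalar_prod_def lessThan_atLeast0 cov_mat_def)
  also have "\<dots> = (\<Sum>i<p. \<Sum>j<p. x $ i * x $ j * integral\<^sup>L M (\<lambda>\<omega>. a \<omega> $ i * a \<omega> $ j))"
    by (simp add: cov_mat_def mean sum_distrib_left mult_ac)
  also have "\<dots> = integral\<^sup>L M (\<lambda>\<omega>. \<Sum>i<p. \<Sum>j<p. x $ i * x $ j * (a \<omega> $ i * a \<omega> $ j))"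
  proof -
    have "integral\<^sup>L M (\<lambda>\<omega>. \<Sum>i<p. \<Sum>j<p. x $ i * x $ j * (a \<omega> $ i * a \<omega> $ j))
        = (\<Sum>i<p. integral\<^sup>L M (\<lambda>\<omega>. \<Sum>j<p. x $ i * x $ j * (a \<omega> $ i * a \<omega> $ j)))"
      by (rule Bochner_Integration.integral_sum) (use int in auto)
    also have "\<dots> = (\<Sum>i<p. \<Sum>j<p. integral\<^sup>L M (\<lambda>\<omega>. x $ i * x $ j * (a \<omega> $ i * a \<omega> $ j)))"
      by (intro sum.cong refl Bochner_Integration.integral_sum) (use int in auto)
    finally show ?thesis by simp
  qed
  also have "\<dots> = integral\<^sup>L M (\<lambda>\<omega>. (x \<bullet> a \<omega>)\<^sup>2)"
  proof (rule Bochner_Integration.integral_cong[OF refl])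
    fix \<omega> assume "\<omega> \<in> space M"
    then have "a \<omega> \<in> carrier_vec p" using measurable_space[OF a] by simp
    then show "(\<Sum>i<p. \<Sum>j<p. x $ i * x $ j * (a \<omega> $ i * a \<omega> $ j)) = (x \<bullet> a \<omega>)\<^sup>2"
      by (simp add: scalar_prod_eq_sum power2_eq_square sum_product mult_ac)
  qed
  finally show ?thesis .
qed

text \<open>The row scaling \<open>1 / sqrt n\<close> becomes \<open>1 / n\<close> after squaring,
  so the squared norm is an empirical mean.\<close>

lemma l2_norm_design_mat:
  assumes "\<And>i. i < n \<Longrightarrow> a i \<omega> \<in> carrier_vec p" "x \<in> carrier_vec p"
  shows "l2_norm (design_mat n p a \<omega> *\<^sub>v x) = sqrt ((\<Sum>i<n. (x \<bullet> a i \<omega>)\<^sup>2) / n)"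
proof -
  have row: "row (design_mat n p a \<omega>) i = (1 / sqrt n) \<cdot>\<^sub>v a i \<omega>" if "i < n" for i
    unfolding design_mat_def using that assms by (subst mat_of_rows_row) auto
  have "(\<Sum>i<n. ((design_mat n p a \<omega> *\<^sub>v x) $ i)\<^sup>2) = (\<Sum>i<n. (x \<bullet> a i \<omega>)\<^sup>2 / n)"
  proof (rule sum.cong[OF refl])
    fix i assume "i \<in> {..<n}"
    then have i: "i < n" by simp
    then have "(design_mat n p a \<omega> *\<^sub>v x) $ i = ((1 / sqrt n) \<cdot>\<^sub>v a i \<omega>) \<bullet> x"
      by (simp add: row[symmetric]) (simp add: design_mat_def)
    also have "\<dots> = (x \<bullet> a i \<omega>) / sqrt n"
      using assms(1)[OF i] assms(2) by (simp add: comm_scalar_prod[of x p])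
    finally show "((design_mat n p a \<omega> *\<^sub>v x) $ i)\<^sup>2 = (x \<bullet> a i \<omega>)\<^sup>2 / n"
      by (simp add: power_divide)
  qed
  then show ?thesis
    by (simp add: l2_norm_def sum_divide_distrib) (simp add: design_mat_def)
qed

section \<open>One-dimensional marginals of the sample\<close>

text \<open>The moment bounds are applied with \<open>s = 2 * \<bar>U\<bar>\<close>, strictly above
  the norm bound, whence the factor \<open>2 ^ 3 / 2 = 4\<close>. The absolute value also covers
  negative \<open>U\<close>, where \<open>ennreal U\<close> is 0.\<close>

lemma subgaussian_marginal_moments:
  fixes x :: "real vec"
  assumes a: "a \<in> M \<rightarrow>\<^sub>M vec_borel p" and psi: "psi2_norm_vec M p a \<le> ennreal U"
    and U: "U \<noteq> 0" and x: "x \<in> carrier_vec p" "l2_norm x = 1"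
  shows "integrable M (\<lambda>\<omega>. (x \<bullet> a \<omega>)\<^sup>2)" "integrable M (\<lambda>\<omega>. (x \<bullet> a \<omega>) ^ 4)"
    "integral\<^sup>L M (\<lambda>\<omega>. (x \<bullet> a \<omega>) ^ 4) \<le> 4 * \<bar>U\<bar> ^ 3 * (integral\<^sup>L M (\<lambda>\<omega>. (x \<bullet> a \<omega>)\<^sup>2) + 54)"
proof -
  have "psi2_norm M (\<lambda>\<omega>. x \<bullet> a \<omega>) \<le> psi2_norm_vec M p a"
    unfolding psi2_norm_vec_def using x by (intro SUP_upper) auto
  also have "\<dots> \<le> ennreal \<bar>U\<bar>"
    using psi by (rule order_trans) (simp add: ennreal_leI)
  finally have le: "(\<integral>\<^sup>+\<omega>. ennreal (exp ((x \<bullet> a \<omega>)\<^sup>2 / (2 * \<bar>U\<bar>)\<^sup>2)) \<partial>M) \<le> 2"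
    by (rule psi2_norm_leD) (use U in auto)
  have meas: "(\<lambda>\<omega>. x \<bullet> a \<omega>) \<in> borel_measurable M"
    using measurable_compose[OF a scalar_prod_measurable] .
  note mom = subgaussian_moments[OF meas _ le]
  show "integrable M (\<lambda>\<omega>. (x \<bullet> a \<omega>)\<^sup>2)" "integrable M (\<lambda>\<omega>. (x \<bullet> a \<omega>) ^ 4)"
    "integral\<^sup>L M (\<lambda>\<omega>. (x \<bullet> a \<omega>) ^ 4) \<le> 4 * \<bar>U\<bar> ^ 3 * (integral\<^sup>L M (\<lambda>\<omega>. (x \<bullet> a \<omega>)\<^sup>2) + 54)"
    using mom U by (simp_all add: power_mult_distrib field_simps)
qed

text \<open>The second moment is the quadratic form of \<open>S\<close> at \<open>x\<close>. The
  same identity for every vector shows that \<open>S\<close> is positive semidefinite, as the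
  singular value bounds require.\<close>

lemma subgaussian_sample_second_moment:
  fixes a :: "nat \<Rightarrow> 'w \<Rightarrow> real vec"
  assumes samp: "subgaussian_sample M n p a U S \<zeta>" and n: "1 \<le> n" and p: "1 \<le> p"
    and U: "U \<noteq> 0" and x: "x \<in> carrier_vec p" "l2_norm x = 1"
  shows "(1 - \<zeta>)\<^sup>2 \<le> integral\<^sup>L M (\<lambda>\<omega>. (x \<bullet> a 0 \<omega>)\<^sup>2)"
    "integral\<^sup>L M (\<lambda>\<omega>. (x \<bullet> a 0 \<omega>)\<^sup>2) \<le> (1 + \<zeta>)\<^sup>2"
proof -
  have cov: "cov_mat M p (a 0) = S" and psi: "psi2_norm_vec M p (a 0) \<le> ennreal U"
    and mean: "mean_vec M p (a 0) = 0\<^sub>v p"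
    and sig: "sigma_min S = (1 - \<zeta>)\<^sup>2" "sigma_max S = (1 + \<zeta>)\<^sup>2"
    and ps: "prob_space M" and iid: "iid_vecs M p n a"
    using samp by (auto simp: subgaussian_sample_def)
  have a: "a 0 \<in> M \<rightarrow>\<^sub>M vec_borel p"
    using iid n unfolding iid_vecs_def prob_space.indep_vars_def2[OF ps] by auto
  \<comment> \<open>Each coordinate is the marginal along a standard basis vector.\<close>
  have sq: "integrable M (\<lambda>\<omega>. (a 0 \<omega> $ j)\<^sup>2)" if j: "j < p" for j
  proof -
    have "(\<Sum>i<p. (unit_vec p j $ i :: real)\<^sup>2) = (\<Sum>i<p. if i = j then 1 else 0)"
      using j by (intro sum.cong) (auto simp: index_unit_vec)
    then have "l2_norm (unit_vec p j) = 1"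
      using j by (simp add: l2_norm_def)
    then have "integrable M (\<lambda>\<omega>. (unit_vec p j \<bullet> a 0 \<omega>)\<^sup>2)"
      by (intro subgaussian_marginal_moments[OF a psi U]) auto
    then show ?thesis
    proof (rule Bochner_Integration.integrable_cong[THEN iffD1, rotated 2])
      fix \<omega> assume "\<omega> \<in> space M"
      then have "a 0 \<omega> \<in> carrier_vec p" using measurable_space[OF a] by simp
      then show "(unit_vec p j \<bullet> a 0 \<omega>)\<^sup>2 = (a 0 \<omega> $ j)\<^sup>2"
        using j by (simp add: scalar_prod_left_unit)
    qed simp
  qed
  have quad: "y \<bullet> (S *\<^sub>v y) = integral\<^sup>L M (\<lambda>\<omega>. (y \<bullet> a 0 \<omega>)\<^sup>2)" if "y \<in> carrier_vec p" for y
    unfolding cov[symmetric] by (rule cov_mat_quadratic_form[OF a mean sq that])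
  have "S \<in> carrier_mat p p" "transpose_mat S = S"
    unfolding cov[symmetric] cov_mat_def by (auto intro!: eq_matI simp: mult.commute)
  from sigma_quadratic_form_bounds[OF p this _ x]
  show "(1 - \<zeta>)\<^sup>2 \<le> integral\<^sup>L M (\<lambda>\<omega>. (x \<bullet> a 0 \<omega>)\<^sup>2)"
    "integral\<^sup>L M (\<lambda>\<omega>. (x \<bullet> a 0 \<omega>)\<^sup>2) \<le> (1 + \<zeta>)\<^sup>2"
    using quad x sig by simp_all
qed

lemma subgaussian_sample_deviation:
  fixes a :: "nat \<Rightarrow> 'w \<Rightarrow> real vec"
  assumes samp: "subgaussian_sample M n p a U S \<zeta>" and n: "1 \<le> n" and p: "1 \<le> p"
    and U: "U \<noteq> 0" and x: "x \<in> carrier_vec p" "l2_norm x = 1"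
    and zeta: "0 < \<zeta>" "\<zeta> < 1" and d: "0 < d"
  defines "m \<equiv> integral\<^sup>L M (\<lambda>\<omega>. (x \<bullet> a 0 \<omega>)\<^sup>2)"
  shows "measure M {\<omega> \<in> space M. d \<le> \<bar>(\<Sum>i<n. (x \<bullet> a i \<omega>)\<^sup>2) / n - m\<bar>}
    \<le> 232 * \<bar>U\<bar> ^ 3 / (n * d\<^sup>2)"
proof -
  have psi: "psi2_norm_vec M p (a 0) \<le> ennreal U"
    and ps: "prob_space M" and iid: "iid_vecs M p n a"
    using samp by (auto simp: subgaussian_sample_def)
  interpret prob_space M by (rule ps)
  have ind: "indep_vars (\<lambda>_. vec_borel p) a {..<n}"
    and same: "\<And>i. i < n \<Longrightarrow> distr M (vec_borel p) (a i) = distr M (vec_borel p) (a 0)"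
    using iid unfolding iid_vecs_def by blast+
  have a: "a i \<in> M \<rightarrow>\<^sub>M vec_borel p" if "i < n" for i
    using ind that by (auto simp: indep_vars_def2)
  \<comment> \<open>Integrals of functions of \<open>a i\<close> depend only on its law, so equality
    in distribution reduces every moment to the one for \<open>a 0\<close>.\<close>
  have transfer: "integrable M (\<lambda>\<omega>. f (a i \<omega>)) \<longleftrightarrow> integrable M (\<lambda>\<omega>. f (a 0 \<omega>))"
    "integral\<^sup>L M (\<lambda>\<omega>. f (a i \<omega>)) = integral\<^sup>L M (\<lambda>\<omega>. f (a 0 \<omega>))"
    if i: "i < n" and f: "f \<in> borel_measurable (vec_borel p)" for i and f :: "real vec \<Rightarrow> real"
  proof -
    have a0: "a 0 \<in> M \<rightarrow>\<^sub>M vec_borel p" using a n by simp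
    show "integrable M (\<lambda>\<omega>. f (a i \<omega>)) \<longleftrightarrow> integrable M (\<lambda>\<omega>. f (a 0 \<omega>))"
      unfolding integrable_distr_eq[OF a[OF i] f, symmetric] integrable_distr_eq[OF a0 f, symmetric]
        same[OF i] ..
    show "integral\<^sup>L M (\<lambda>\<omega>. f (a i \<omega>)) = integral\<^sup>L M (\<lambda>\<omega>. f (a 0 \<omega>))"
      unfolding integral_distr[OF a[OF i] f, symmetric] integral_distr[OF a0 f, symmetric]
        same[OF i] ..
  qed
  have f2: "(\<lambda>v. (x \<bullet> v)\<^sup>2) \<in> borel_measurable (vec_borel p)"
    and f4: "(\<lambda>v. (x \<bullet> v) ^ 4) \<in> borel_measurable (vec_borel p)"
    by (intro borel_measurable_power scalar_prod_measurable)+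
  have a0: "a 0 \<in> M \<rightarrow>\<^sub>M vec_borel p" using a n by simp
  note mom = subgaussian_marginal_moments[OF a0 psi U x]
  \<comment> \<open>Since \<open>\<zeta> < 1\<close>, the second moment is at most 4, and
    \<open>4 * (4 + 54) = 232\<close>.\<close>
  have "m \<le> (1 + \<zeta>)\<^sup>2"
    unfolding m_def by (rule subgaussian_sample_second_moment[OF samp n p U x])
  also have "\<dots> \<le> 2\<^sup>2" using zeta by (intro power_mono) auto
  finally have "4 * \<bar>U\<bar> ^ 3 * (m + 54) \<le> 4 * \<bar>U\<bar> ^ 3 * 58"
    by (intro mult_left_mono) auto
  with mom(3) have V: "integral\<^sup>L M (\<lambda>\<omega>. (x \<bullet> a 0 \<omega>) ^ 4) \<le> 232 * \<bar>U\<bar> ^ 3"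
    by (simp add: m_def)
  show ?thesis
  proof (rule indep_mean_deviation[OF _ n d])
    show "indep_vars (\<lambda>_. borel) (\<lambda>i \<omega>. (x \<bullet> a i \<omega>)\<^sup>2) {..<n}"
      by (rule indep_vars_compose2[OF ind f2])
    show "expectation (\<lambda>\<omega>. (x \<bullet> a i \<omega>)\<^sup>2) = m" if "i < n" for i
      using transfer(2)[OF that f2] by (simp add: m_def)
    show "integrable M (\<lambda>\<omega>. ((x \<bullet> a i \<omega>)\<^sup>2)\<^sup>2)" if "i < n" for i
      using transfer(1)[OF that f4] mom(2) by simp
    show "expectation (\<lambda>\<omega>. ((x \<bullet> a i \<omega>)\<^sup>2)\<^sup>2) \<le> 232 * \<bar>U\<bar> ^ 3" if "i < n" for i
      using transfer(2)[OF that f4] V by simp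
  qed
qed

section \<open>From squared norms to norms\<close>

lemma norm_bounds_of_mean_square_close:
  fixes \<zeta> m w :: real
  assumes zeta: "0 < \<zeta>" "\<zeta> < 1" and m: "(1 - \<zeta>)\<^sup>2 \<le> m" "m \<le> (1 + \<zeta>)\<^sup>2"
    and w: "\<bar>w - m\<bar> < (1 - \<zeta>)\<^sup>2 / 2"
  shows "1 - \<zeta> - 2 powr (- 1 / 2) * (1 - \<zeta>) \<le> sqrt w"
    "sqrt w \<le> 1 + \<zeta> + 2 powr (- 1 / 2) * (1 - \<zeta>)"
proof -
  define r :: real where "r = 2 powr (- 1 / 2)"
  have "r > 0" by (simp add: r_def)
  have "r\<^sup>2 = 2 powr (-1)"
    unfolding r_def by (simp add: power2_eq_square powr_add[symmetric])
  then have r2: "r\<^sup>2 = 1 / 2" by (simp add: powr_minus_divide)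
  have "r \<ge> 1 / 2"
    by (rule power2_le_imp_le) (use \<open>r > 0\<close> in \<open>simp_all add: r2\<close>, simp add: power2_eq_square)
  \<comment> \<open>With \<open>r^2 = 1 / 2\<close> and \<open>r \<ge> 1 / 2\<close>, the factor
    \<open>(1 - r)^2\<close> is at most \<open>1 / 2\<close>, and \<open>w\<close> stays above half
    of \<open>(1 - \<zeta>)^2\<close>.\<close>
  have "(1 - \<zeta> - r * (1 - \<zeta>))\<^sup>2 = (1 - \<zeta>)\<^sup>2 * (1 - 2 * r + r\<^sup>2)"
    by (simp add: power2_eq_square algebra_simps)
  also have "\<dots> \<le> (1 - \<zeta>)\<^sup>2 * (1 / 2)"
    using \<open>r \<ge> 1 / 2\<close> by (intro mult_left_mono) (auto simp: r2)
  also have "\<dots> \<le> w" using w m by linarith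
  finally show "1 - \<zeta> - 2 powr (- 1 / 2) * (1 - \<zeta>) \<le> sqrt w"
    unfolding r_def[symmetric] by (rule real_le_rsqrt)
  \<comment> \<open>For the upper bound, the allowed deviation is
    \<open>(r * (1 - \<zeta>))^2\<close>; adding the nonnegative cross term completes the
    square.\<close>
  have "w \<le> (1 + \<zeta>)\<^sup>2 + r\<^sup>2 * (1 - \<zeta>)\<^sup>2" using w m unfolding r2 by linarith
  also have "\<dots> \<le> (1 + \<zeta>)\<^sup>2 + r\<^sup>2 * (1 - \<zeta>)\<^sup>2 + 2 * (1 + \<zeta>) * (r * (1 - \<zeta>))"
    using zeta \<open>r > 0\<close> by simp
  also have "\<dots> = (1 + \<zeta> + r * (1 - \<zeta>))\<^sup>2"
    by (simp add: power2_eq_square algebra_simps)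
  finally show "sqrt w \<le> 1 + \<zeta> + 2 powr (- 1 / 2) * (1 - \<zeta>)"
    unfolding r_def[symmetric] using zeta \<open>r > 0\<close> by (intro real_le_lsqrt) auto
qed

lemma subgaussian_sample_norm_bounds:
  fixes a :: "nat \<Rightarrow> 'w \<Rightarrow> real vec"
  assumes samp: "subgaussian_sample M n p a U S \<zeta>" and n: "1 \<le> n" and p: "1 \<le> p"
    and U: "U \<noteq> 0" and x: "x \<in> carrier_vec p" "l2_norm x = 1"
    and zeta: "0 < \<zeta>" "\<zeta> < 1"
  shows "1 - 928 * \<bar>U\<bar> ^ 3 / (n * (1 - \<zeta>) ^ 4) \<le> measure M {\<omega> \<in> space M.
      1 - \<zeta> - 2 powr (- 1 / 2) * (1 - \<zeta>) \<le> l2_norm (design_mat n p a \<omega> *\<^sub>v x) \<and>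
      l2_norm (design_mat n p a \<omega> *\<^sub>v x) \<le> 1 + \<zeta> + 2 powr (- 1 / 2) * (1 - \<zeta>)}"
    (is "_ \<le> measure M ?G")
proof -
  have ps: "prob_space M" and iid: "iid_vecs M p n a"
    using samp by (auto simp: subgaussian_sample_def)
  interpret prob_space M by (rule ps)
  have a: "a i \<in> M \<rightarrow>\<^sub>M vec_borel p" if "i < n" for i
    using iid that by (auto simp: iid_vecs_def indep_vars_def2)
  have car: "a i \<omega> \<in> carrier_vec p" if "i < n" "\<omega> \<in> space M" for i \<omega>
    using measurable_space[OF a[OF that(1)] that(2)] by simp
  have meas: "(\<lambda>\<omega>. x \<bullet> a i \<omega>) \<in> borel_measurable M" if "i < n" for i
    using measurable_compose[OF a[OF that] scalar_prod_measurable] .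
  define m where "m = integral\<^sup>L M (\<lambda>\<omega>. (x \<bullet> a 0 \<omega>)\<^sup>2)"
  define W where "W \<omega> = (\<Sum>i<n. (x \<bullet> a i \<omega>)\<^sup>2) / n" for \<omega>
  define d where "d = (1 - \<zeta>)\<^sup>2 / 2"
  define B where "B = {\<omega> \<in> space M. d \<le> \<bar>W \<omega> - m\<bar>}"
  have [measurable]: "W \<in> borel_measurable M"
    unfolding W_def using meas by auto
  have G: "?G = {\<omega> \<in> space M. 1 - \<zeta> - 2 powr (- 1 / 2) * (1 - \<zeta>) \<le> sqrt (W \<omega>) \<and>
      sqrt (W \<omega>) \<le> 1 + \<zeta> + 2 powr (- 1 / 2) * (1 - \<zeta>)}"
    using l2_norm_design_mat[of n a _ p x] car x by (auto simp: W_def)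
  have "?G \<in> sets M" unfolding G by measurable
  have "B \<in> sets M" unfolding B_def by measurable
  \<comment> \<open>Outside the deviation event \<open>B\<close> the empirical mean is close enough
    for both norm bounds.\<close>
  have "space M - B \<subseteq> ?G"
    unfolding G B_def
    using norm_bounds_of_mean_square_close[OF zeta]
      subgaussian_sample_second_moment[OF samp n p U x]
    by (auto simp: m_def d_def)
  then have "prob (space M - B) \<le> prob ?G"
    using \<open>?G \<in> sets M\<close> by (intro finite_measure_mono)
  moreover have "prob (space M - B) = 1 - prob B"
    using \<open>B \<in> sets M\<close> by (rule prob_compl)
  moreover have "prob B \<le> 232 * \<bar>U\<bar> ^ 3 / (n * d\<^sup>2)"
    unfolding B_def W_def m_def
    by (rule subgaussian_sample_deviation[OF samp n p U x zeta]) (use zeta in \<open>simp add: d_def\<close>)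
  \<comment> \<open>Here \<open>d^2 = (1 - \<zeta>) ^ 4 / 4\<close>, and
    \<open>928 = 4 * 232\<close>.\<close>
  moreover have "232 * \<bar>U\<bar> ^ 3 / (n * d\<^sup>2) = 928 * \<bar>U\<bar> ^ 3 / (n * (1 - \<zeta>) ^ 4)"
    by (simp add: d_def power_divide power_mult[symmetric])
  ultimately show ?thesis by simp
qed

section \<open>Growth condition and choice of constants\<close>

text \<open>The hypotheses force \<open>U ^ 4 \<le> (K / ln 2) * n\<close>, so the left side is a
  constant times \<open>n powr (- 1 / 4)\<close>. Half of this decay is spent on the constant: the
  eighth-power condition on \<open>n\<close> says that \<open>n powr (1 / 8)\<close> dominates it.
  The number 464 is half of 928, which leaves the factor 2.\<close>

lemma tail_term_le:
  fixes U f K \<zeta> :: real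
  assumes f: "f \<le> K * real n" and L: "ln 2 < f * U powi (-4)" and U: "U \<noteq> 0"
    and K: "0 < K" and zeta: "\<zeta> < 1"
    and n: "(464 * (K / ln 2) powr (3 / 4) / (1 - \<zeta>) ^ 4) ^ 8 \<le> real n" "1 \<le> n"
  shows "928 * \<bar>U\<bar> ^ 3 / (n * (1 - \<zeta>) ^ 4) \<le> 2 * real n powr (- (1 / 8))"
proof -
  define Q where "Q = K / ln 2"
  define c where "c = (1 - \<zeta>) ^ 4"
  have c: "c > 0" using zeta by (simp add: c_def)
  have Q: "Q > 0" using K by (simp add: Q_def)
  have np: "real n > 0" using n by simp
  have "U ^ 4 > 0" using U by simp
  have "U powi (-4) = 1 / U ^ 4"
    by (simp add: power_int_def divide_inverse power_inverse)
  then have "U ^ 4 * ln 2 < f" using L \<open>U ^ 4 > 0\<close> by (simp add: field_simps)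
  then have "U ^ 4 \<le> Q * n" using f by (simp add: Q_def field_simps)
  then have "(U ^ 4) powr (3 / 4) \<le> (Q * n) powr (3 / 4)"
    using \<open>U ^ 4 > 0\<close> by (intro powr_mono2) auto
  moreover have "(U ^ 4) powr (3 / 4) = \<bar>U\<bar> ^ 3"
  proof -
    have "U ^ 4 = \<bar>U\<bar> powr 4" using U by (simp add: powr_numeral)
    then have "(U ^ 4) powr (3 / 4) = \<bar>U\<bar> powr (4 * (3 / 4))" by (simp only: powr_powr)
    then show ?thesis using U by (simp add: powr_numeral)
  qed
  ultimately have U3: "\<bar>U\<bar> ^ 3 \<le> Q powr (3 / 4) * n powr (3 / 4)"
    using Q by (simp add: powr_mult)
  have "464 * Q powr (3 / 4) / c \<le> n powr (1 / 8)"
  proof (rule power_le_imp_le_base[of _ 7])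
    have "(n powr (1 / 8)) ^ 8 = real n"
      using np by (simp add: powr_realpow[symmetric] powr_powr)
    then show "(464 * Q powr (3 / 4) / c) ^ Suc 7 \<le> (n powr (1 / 8)) ^ Suc 7"
      using n(1) by (simp add: Q_def c_def)
  qed simp
  then have key: "464 * Q powr (3 / 4) \<le> n powr (1 / 8) * c"
    using c by (simp add: field_simps)
  have "928 * \<bar>U\<bar> ^ 3 / (n * c) \<le> 2 * (464 * Q powr (3 / 4)) * n powr (3 / 4) / (n * c)"
    using U3 c by (intro divide_right_mono) auto
  also have "\<dots> \<le> 2 * (n powr (1 / 8) * c) * n powr (3 / 4) / (n * c)"
    using key c by (intro divide_right_mono mult_right_mono mult_left_mono) auto
  also have "\<dots> = 2 * (n powr (1 / 8) * n powr (3 / 4) / n powr 1)"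
    using c np by simp
  also have "n powr (1 / 8) * n powr (3 / 4) / n powr 1 = n powr (- (1 / 8))"
    by (simp only: powr_add[symmetric] powr_diff[symmetric]) simp
  finally show ?thesis by (simp add: c_def)
qed

lemma TV_class_norm_concentration:
  fixes a :: "nat \<Rightarrow> 'w \<Rightarrow> real vec"
  assumes zeta: "0 < \<zeta>" "\<zeta> < 1" and c: "0 < c1" "0 < c2" and n: "1 \<le> n"
    and N: "(464 * (c2 / c1 / ln 2) powr (3 / 4) / (1 - \<zeta>) ^ 4) ^ 8 \<le> real n"
    and p: "1 \<le> p" and samp: "subgaussian_sample M n p a U S \<zeta>"
    and le: "c1 * sqrt (real n) * f \<le> c2 * real n powr (3 / 2)"
    and x: "x \<in> TV_class p t"
  shows "1 - 2 * real n powr (- (1 / 8)) - 2 * exp (- 1 * U powi (-4) * f) \<le>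
    measure M {\<omega> \<in> space M.
      1 - \<zeta> - 2 powr (- 1 / 2) * (1 - \<zeta>) \<le> l2_norm (design_mat n p a \<omega> *\<^sub>v x) \<and>
      l2_norm (design_mat n p a \<omega> *\<^sub>v x) \<le> 1 + \<zeta> + 2 powr (- 1 / 2) * (1 - \<zeta>)}"
    (is "_ \<le> ?P")
proof (cases "f * U powi (-4) \<le> ln 2")
  case True
  \<comment> \<open>The exponential term alone is at least 1, so the claimed lower bound is not
    positive.\<close>
  then have "exp (- ln 2) \<le> exp (- 1 * U powi (-4) * f)"
    by (simp add: mult.commute)
  then have "1 \<le> 2 * exp (- 1 * U powi (-4) * f)"
    by (simp add: exp_minus)
  moreover have "0 \<le> 2 * real n powr (- (1 / 8))" by simp
  moreover have "0 \<le> ?P" by simp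
  ultimately show ?thesis by linarith
next
  case False
  \<comment> \<open>For \<open>U = 0\<close> the convention \<open>inverse 0 = 0\<close> makes
    \<open>U powi (-4)\<close> vanish, which belongs to the first case.\<close>
  then have U: "U \<noteq> 0" by auto
  have x': "x \<in> carrier_vec p" "l2_norm x = 1" using x by (auto simp: TV_class_def)
  \<comment> \<open>Cancelling \<open>sqrt n\<close> in the growth condition leaves a bound on
    \<open>f\<close> that is linear in \<open>n\<close>.\<close>
  have "real n powr (3 / 2) = sqrt n * n"
    using n powr_add[of "real n" "1 / 2" 1] by (simp add: powr_half_sqrt)
  then have "sqrt n * (c1 * f) \<le> sqrt n * (c2 * n)"
    using le by (simp add: mult_ac)
  then have "c1 * f \<le> c2 * n"
    using n by (subst (asm) mult_le_cancel_left_pos) auto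
  then have "f \<le> c2 / c1 * n"
    using c by (simp add: field_simps)
  then have "928 * \<bar>U\<bar> ^ 3 / (n * (1 - \<zeta>) ^ 4) \<le> 2 * real n powr (- (1 / 8))"
    using False U c zeta n N by (intro tail_term_le[of f "c2 / c1"]) auto
  moreover have "1 - 928 * \<bar>U\<bar> ^ 3 / (n * (1 - \<zeta>) ^ 4) \<le> ?P"
    by (rule subgaussian_sample_norm_bounds[OF samp n p U x' zeta])
  moreover have "0 \<le> 2 * exp (- 1 * U powi (-4) * f)" by simp
  ultimately show ?thesis by linarith
qed

theorem proposition2:
  shows "\<exists>c3 > 0. \<exists>c4 > 0. \<forall>(\<zeta>::real) (c1::real) (c2::real).
    0 < \<zeta> \<and> \<zeta> < 1 \<and> 0 < c1 \<and> 0 < c2 \<longrightarrow>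
    (\<exists>N::nat. \<forall>(M :: nat \<Rightarrow> 'w measure) (a :: nat \<Rightarrow> nat \<Rightarrow> 'w \<Rightarrow> real vec) (S :: nat \<Rightarrow> real mat)
        (p :: nat \<Rightarrow> nat) (t :: nat \<Rightarrow> real) (U :: nat \<Rightarrow> real) (\<phi> :: nat \<Rightarrow> real).
      filterlim \<phi> at_top sequentially \<and>
      filterlim (\<lambda>n. \<phi> n * U n powi (-4)) at_top sequentially \<longrightarrow>
      (\<forall>n \<ge> N.
        1 \<le> n \<and> 1 \<le> p n \<and> 0 \<le> t n \<and>
        subgaussian_sample (M n) n (p n) (a n) (U n) (S n) \<zeta> \<and>
        c1 * sqrt (real n) * \<phi> n
          \<le> (t n * sqrt (real (p n)) + ln (real (p n))) * (sqrt (real (p n)) + sqrt (ln (real n))) \<and>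
        (t n * sqrt (real (p n)) + ln (real (p n))) * (sqrt (real (p n)) + sqrt (ln (real n)))
          \<le> c2 * real n powr (3 / 2) \<longrightarrow>
        (\<forall>x \<in> TV_class (p n) (t n).
          measure (M n) {\<omega> \<in> space (M n).
              1 - \<zeta> - 2 powr (- 1 / 2) * (1 - \<zeta>) \<le> l2_norm (design_mat n (p n) (a n) \<omega> *\<^sub>v x) \<and>
              l2_norm (design_mat n (p n) (a n) \<omega> *\<^sub>v x) \<le> 1 + \<zeta> + 2 powr (- 1 / 2) * (1 - \<zeta>)}
            \<ge> 1 - 2 * real n powr (- c3) - 2 * exp (- c4 * U n powi (-4) * \<phi> n))))"
\<comment> \<open>The exponents are \<open>1 / 8\<close> and 1. The threshold \<open>N\<close> stays
  schematic until the assumption on \<open>n\<close> instantiates it; it is built from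
  \<open>\<zeta>\<close>, \<open>c1\<close> and \<open>c2\<close> only, hence is uniform over
  samples, dimensions and levels.\<close>
proof (rule exI[of _ "1 / 8"], rule conjI, simp, rule exI[of _ 1], rule conjI, simp,
    intro allI impI, rule exI, intro allI impI ballI)
  fix \<zeta> c1 c2 :: real and M :: "nat \<Rightarrow> 'w measure" and a :: "nat \<Rightarrow> nat \<Rightarrow> 'w \<Rightarrow> real vec"
    and S :: "nat \<Rightarrow> real mat" and p :: "nat \<Rightarrow> nat" and t U \<phi> :: "nat \<Rightarrow> real"
    and n :: nat and x :: "real vec"
  assume c: "0 < \<zeta> \<and> \<zeta> < 1 \<and> 0 < c1 \<and> 0 < c2"
    and n: "nat \<lceil>(464 * (c2 / c1 / ln 2) powr (3 / 4) / (1 - \<zeta>) ^ 4) ^ 8\<rceil> \<le> n"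
    and H: "1 \<le> n \<and> 1 \<le> p n \<and> 0 \<le> t n \<and>
        subgaussian_sample (M n) n (p n) (a n) (U n) (S n) \<zeta> \<and>
        c1 * sqrt (real n) * \<phi> n
          \<le> (t n * sqrt (real (p n)) + ln (real (p n))) * (sqrt (real (p n)) + sqrt (ln (real n))) \<and>
        (t n * sqrt (real (p n)) + ln (real (p n))) * (sqrt (real (p n)) + sqrt (ln (real n)))
          \<le> c2 * real n powr (3 / 2)"
    and x: "x \<in> TV_class (p n) (t n)"
  have "(464 * (c2 / c1 / ln 2) powr (3 / 4) / (1 - \<zeta>) ^ 4) ^ 8 \<le> real n"
    using n by linarith
  \<comment> \<open>Chaining the two growth inequalities eliminates the middle expression in
    \<open>t\<close> and \<open>p\<close>.\<close>
  moreover have "c1 * sqrt (real n) * \<phi> n \<le> c2 * real n powr (3 / 2)"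
    using H by linarith
  ultimately show "1 - 2 * real n powr (- (1 / 8)) - 2 * exp (- 1 * U n powi (-4) * \<phi> n)
      \<le> measure (M n) {\<omega> \<in> space (M n).
        1 - \<zeta> - 2 powr (- 1 / 2) * (1 - \<zeta>) \<le> l2_norm (design_mat n (p n) (a n) \<omega> *\<^sub>v x) \<and>
        l2_norm (design_mat n (p n) (a n) \<omega> *\<^sub>v x) \<le> 1 + \<zeta> + 2 powr (- 1 / 2) * (1 - \<zeta>)}"
    using c H x by (intro TV_class_norm_concentration[of _ c1 c2 _ _ _ _ _ "S n"]) auto
qed

end
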